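(* For every integer $k \geq 3$ there exists $N_0 = N_0(k)$ such that for all integers $N \geq N_0$, $$\log(\#\mathfrak{E}_N) > \frac{N}{\log N} \prod_{j=3}^{k} \log_j N .$$
   Context: For each integer $N \geq 1$, $\mathfrak{E}_N := \left\{\sum_{n=1}^N \frac{t_n}{n} : t_1,\dots,t_N \in \{0,1\}\right\}$, a finite set of rational numbers, and $\#\mathfrak{E}_N$ is its cardinality. Iterated logarithms: $\log_1 x := \log x$ and $\log_{j+1} x := \log(\log_j x)$ for every integer $j \geq 1$ and every sufficiently large $x$. *)

theory Defs
  imports Complex_Main
begin

definition egyptian_sums :: "nat \<Rightarrow> rat set" where
  "egyptian_sums N =
     {(\<Sum>n=1..N. t n / of_nat n) | t. \<forall>n\<in>{1..N}. t n \<in> {0, 1}}"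

(* The paper's iterated logarithms start at index 1; index 0 is the identity here.
   The function ln is total, so iter_log j x has its intended meaning only for x so large
   that every iterated logarithm of lower index is positive. *)
primrec iter_log :: "nat \<Rightarrow> real \<Rightarrow> real" where
  "iter_log 0 x = x"
| "iter_log (Suc j) x = ln (iter_log j x)"

end

theory Submission
  imports
    Defs
    "HOL-Analysis.Harmonic_Numbers"
    "HOL-Computational_Algebra.Computational_Algebra"
    "HOL-Real_Asymp.Real_Asymp"
begin

text \<open>
  Let \<open>L(N)\<close> be the logarithm of the number of subset sums, and let \<open>M\<close> be the integer part of
  \<open>sqrt (ln N)\<close>. Group the denominators by their prime factor \<open>p \<in> (N/M, N]\<close>: the sums
  \<open>\<Sum>\<^sub>p e\<^sub>p / p\<close> with \<open>e\<^sub>p\<close> a subset sum for \<open>\<lfloor>N/p\<rfloor>\<close> are pairwise distinct, because the difference of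
  two choices of \<open>e\<^sub>p\<close> is \<open>d / M!\<close> with \<open>\<bar>d\<bar> \<le> M \<cdot> M! < p\<close>, and clearing denominators forces
  \<open>p\<close> to divide \<open>d\<close>. Hence \<open>L(N) \<ge> \<Sum>\<^sub>p L(\<lfloor>N/p\<rfloor>)\<close>. Chebyshev's estimate for the number of primes
  in \<open>(x/4, x]\<close> turns this into
  \<open>L(N) \<ge> N / (8 ln N) \<cdot> \<Sum>\<^sub>i L(4\<^sup>i) / 4\<^sup>i\<close>, the sum running up to \<open>i\<close> of order \<open>ln ln N\<close>.
  If \<open>L(n)\<close> is at least a constant times \<open>n / ln n \<cdot> F(n)\<close>, then the sum is at least of the order of
  \<open>\<Sum>\<^sub>i F(4\<^sup>i) / i\<close>. Restricting to \<open>i \<ge> sqrt (ln ln N / 8)\<close> loses only constants; there the \<open>j\<close>-th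
  iterated logarithm of \<open>4\<^sup>i\<close> is comparable to the \<open>(j+1)\<close>-st of \<open>N\<close>, and \<open>\<Sum>\<^sub>i 1/i\<close> supplies the new
  factor \<open>ln ln ln N\<close>. So each application adds one factor to the product, up to a constant, and
  the constant is absorbed by one further factor.
\<close>

subsection \<open>Chebyshev's lower bound for primes\<close>

(* Induction on d through the harmonic triangle: a(n, m) = 1 / (m * (n choose m)) satisfies
   a(n, m) = a(n - 1, m) - a(n, m + 1). *)
lemma leibniz_triangle_dvd:
  fixes D m d :: nat
  assumes "m \<ge> 1" and "\<And>j. j \<in> {1..m + d} \<Longrightarrow> j dvd D"
  shows "m * ((m + d) choose m) dvd D"
  using assms
proof (induction d arbitrary: m)
  case 0
  then show ?case by simp
next
  case (Suc d)
  define B where "B = (m + d) choose m"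
  have "m * B dvd D"
    unfolding B_def using Suc.prems by (intro Suc.IH) auto
  moreover have "Suc m * ((Suc m + d) choose Suc m) dvd D"
    using Suc.prems by (intro Suc.IH) auto
  moreover have *: "Suc m * ((Suc m + d) choose Suc m) = (m + Suc d) * B"
    unfolding B_def using Suc_times_binomial_eq[of "m + d" m] by (simp add: mult.commute)
  moreover have **: "Suc d * ((m + Suc d) choose m) = (m + Suc d) * B"
    unfolding B_def using binomial_absorb_comp[of "m + Suc d" m] by simp
  ultimately obtain x y where x: "D = m * B * x" and y: "D = (m + Suc d) * B * y"
    unfolding * by (metis dvdE)
  \<comment> \<open>The recurrence with denominators cleared: substituting the \<open>x\<close> form
    of \<open>D\<close> in one term and the \<open>y\<close> form in the other makes
    \<open>Suc d\<close> a factor of both sides, and it cancels.\<close>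
  have "int (Suc d) * int D = (int m + int (Suc d)) * int D - int m * int D"
    by (simp add: algebra_simps)
  also have "\<dots> = int (m + Suc d) * int (m * B * x) - int m * int ((m + Suc d) * B * y)"
    by (simp only: x[symmetric] y[symmetric] of_nat_add)
  also have "\<dots> = int ((m + Suc d) * B) * (int m * (int x - int y))"
    by (simp add: algebra_simps)
  also have "\<dots> = int (Suc d) * (int (m * ((m + Suc d) choose m)) * (int x - int y))"
    unfolding **[symmetric] by (simp only: of_nat_mult mult_ac)
  finally have "int D = int (m * ((m + Suc d) choose m)) * (int x - int y)"
    by (simp only: mult_cancel_left) auto
  then show ?case
    by (metis dvd_triv_left of_nat_dvd_iff)
qed

text \<open>The multiplicity of a prime in an lcm is the maximum of the multiplicities, so some
  element of \<open>A\<close> attains it.\<close>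

lemma prime_power_dvd_Lcm:
  fixes p :: nat
  assumes "prime p" "finite A" "A \<noteq> {}" "0 \<notin> A" "p ^ e dvd Lcm A"
  shows "\<exists>j\<in>A. p ^ e dvd j"
  using assms(2-)
proof (induction A rule: finite_ne_induct)
  case (singleton x)
  then show ?case by simp
next
  case (insert x A)
  have nz: "x \<noteq> 0" "Lcm A \<noteq> 0" using insert by (auto simp: Lcm_0_iff)
  have "p ^ e dvd lcm x (Lcm A)" using insert.prems by simp
  then have "e \<le> multiplicity p (lcm x (Lcm A))"
    using assms(1) nz by (intro multiplicity_geI) (auto simp: lcm_eq_0_iff)
  also have "\<dots> = max (multiplicity p x) (multiplicity p (Lcm A))"
    using assms(1) nz by (intro multiplicity_lcm) auto
  finally have "p ^ e dvd x \<or> p ^ e dvd Lcm A"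
    by (auto simp: le_max_iff_disj intro: multiplicity_dvd')
  then show ?case using insert by auto
qed

text \<open>By \<open>leibniz_triangle_dvd\<close> the binomial divides \<open>Lcm {1..n}\<close>,
  so its full power of \<open>p\<close> divides a single number \<open>j \<le> n\<close>. This takes
  the place of Legendre's formula.\<close>

lemma prime_power_dvd_binomial_le:
  fixes p :: nat
  assumes "prime p" "1 \<le> m" "m \<le> n"
  shows "p ^ multiplicity p (n choose m) \<le> n"
proof -
  have "m * ((m + (n - m)) choose m) dvd Lcm {1..n}"
    using assms by (intro leibniz_triangle_dvd) auto
  then have "n choose m dvd Lcm {1..n}"
    using assms by (auto dest: dvd_mult_right)
  then have "p ^ multiplicity p (n choose m) dvd Lcm {1..n}"
    using multiplicity_dvd dvd_trans by blast
  then obtain j where j: "j \<in> {1..n}" "p ^ multiplicity p (n choose m) dvd j"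
    using prime_power_dvd_Lcm[OF assms(1), of "{1..n}"] assms(2,3)
    by (metis atLeastAtMost_iff empty_iff finite_atLeastAtMost le_trans not_one_le_zero order_refl)
  then show ?thesis by (auto dest: dvd_imp_le)
qed

lemma prod_primes_dvd:
  fixes n :: nat
  assumes "finite A" "\<And>p. p \<in> A \<Longrightarrow> prime p \<and> p dvd n"
  shows "\<Prod>A dvd n"
  using assms
proof (induction A rule: finite_induct)
  case (insert p A)
  have "coprime p (\<Prod>A)"
    using insert by (intro prod_coprime_right) (auto intro!: primes_coprime)
  then show ?case using insert by (simp add: divides_mult)
qed simp

text \<open>Erdos's argument: an even \<open>n > 2\<close> adds no prime, and for
  \<open>n = 2 * m + 1\<close> the primes in (m + 1, n] all divide \<open>n choose m\<close>, which
  is at most \<open>4 ^ m\<close>.\<close>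

lemma primorial_le: "\<Prod>{p::nat. prime p \<and> p \<le> n} \<le> 4 ^ n"
proof (induction n rule: less_induct)
  case (less n)
  consider "n \<le> 1" | "n = 2" | "n > 2" "even n" | m where "n = 2 * m + 1" "m \<ge> 1"
  proof (cases "even n")
    case True
    then show ?thesis using that by linarith
  next
    case False
    then show ?thesis using that by (elim oddE) (cases "n \<le> 1"; simp)
  qed
  then show ?case
  proof cases
    case 1
    then have "{p::nat. prime p \<and> p \<le> n} = {}" by (auto dest: prime_ge_2_nat)
    then show ?thesis by (simp only: prod.empty) simp
  next
    case 2
    then have "{p::nat. prime p \<and> p \<le> n} = {2}" by (auto dest: prime_ge_2_nat)
    then show ?thesis using 2 by simp
  next
    case 3
    have "\<not> prime n" using 3 prime_odd_nat[of n] by auto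
    then have "{p::nat. prime p \<and> p \<le> n} = {p. prime p \<and> p \<le> n - 1}"
      by (auto simp: le_eq_less_or_eq)
    moreover have "\<Prod>{p::nat. prime p \<and> p \<le> n - 1} \<le> 4 ^ (n - 1)"
      using 3 by (intro less) auto
    moreover have "(4::nat) ^ (n - 1) \<le> 4 ^ n" by (intro power_increasing) auto
    ultimately show ?thesis by (metis le_trans)
  next
    case 4
    let ?A = "{p::nat. prime p \<and> p \<le> m + 1}" and ?B = "{p::nat. prime p \<and> m + 1 < p \<and> p \<le> n}"
    have "{p::nat. prime p \<and> p \<le> n} = ?A \<union> ?B" using 4 by auto
    then have eq: "\<Prod>{p::nat. prime p \<and> p \<le> n} = \<Prod>?A * \<Prod>?B"
      by (simp add: prod.union_disjoint disjoint_iff)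
    have "\<Prod>?A \<le> 4 ^ (m + 1)" using 4 by (intro less) auto
    moreover have "\<Prod>?B \<le> 4 ^ m"
    proof -
      have "p dvd n choose m" if "prime p" "m + 1 < p" "p \<le> n" for p
      proof -
        have "p dvd fact n" using that by (simp add: prime_dvd_fact_iff)
        also have "fact n = fact m * fact (m + 1) * (n choose m)"
          using binomial_fact_lemma[of m n] 4 by (simp add: algebra_simps)
        finally show ?thesis using that
          by (auto simp: prime_dvd_mult_iff prime_dvd_fact_iff simp del: fact_Suc)
      qed
      then have "\<Prod>?B dvd n choose m" by (intro prod_primes_dvd) auto
      then have "\<Prod>?B \<le> n choose m" using 4 by (intro dvd_imp_le) auto
      moreover have "2 * (n choose m) \<le> 2 ^ n"
      proof -
        \<comment> \<open>The two middle coefficients of an odd row are equal and fit together into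
          the row sum \<open>2 ^ n\<close>; this gains the factor 2.\<close>
        have "2 * (n choose m) = (\<Sum>k\<in>{m, m + 1}. n choose k)"
          using 4 binomial_symmetric[of m n] by simp
        also have "\<dots> \<le> (\<Sum>k\<le>n. n choose k)" using 4 by (intro sum_mono2) auto
        finally show ?thesis by (simp add: choose_row_sum)
      qed
      ultimately show ?thesis using 4 by (simp add: power_mult)
    qed
    ultimately have "\<Prod>{p::nat. prime p \<and> p \<le> n} \<le> 4 ^ (m + 1) * 4 ^ m"
      unfolding eq by (rule mult_le_mono)
    then show ?thesis using 4 by (simp add: power_add mult_2)
  qed
qed

lemma central_binomial_ge: "2 ^ n \<le> (n + 1) * (n choose (n div 2))"
proof -
  have "2 ^ n = (\<Sum>k\<le>n. n choose k)" by (simp add: choose_row_sum)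
  also have "\<dots> \<le> (\<Sum>k\<le>n. n choose (n div 2))" by (intro sum_mono binomial_maximum)
  finally show ?thesis by simp
qed

text \<open>The central binomial coefficient is factored by the size of its primes. A prime power in
  it is at most \<open>N\<close>, which serves for small and for large primes. If
  \<open>N < p * p\<close>, the exponent is at most 1, so the primes up to \<open>N / 4\<close>
  among these contribute at most a primorial. As \<open>4 ^ (N div 4)\<close> is at most the square
  root of \<open>2 ^ N\<close>, the primes above \<open>N / 4\<close> must supply nearly all the
  rest.\<close>

lemma prime_counting_ineq:
  fixes N :: nat
  assumes "N \<ge> 2"
  shows "2 ^ N \<le> (N + 1) * (N ^ card {p. prime p \<and> p * p \<le> N} * 4 ^ (N div 4)
           * N ^ card {p. prime p \<and> p \<le> N \<and> N < 4 * p})"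
proof -
  define C where "C = N choose (N div 2)"
  define q where "q p = p ^ multiplicity p C" for p
  define S where "S = {p. prime p \<and> p \<le> N}"
  define S1 where "S1 = {p. prime p \<and> p * p \<le> N}"
  define S2 where "S2 = {p. prime p \<and> N < p * p \<and> 4 * p \<le> N}"
  \<comment> \<open>The condition \<open>N < p * p\<close> keeps the ranges disjoint for small
    \<open>N\<close> too; the bound on \<open>prod q S3\<close> then enlarges \<open>S3\<close> to
    the whole block.\<close>
  define S3 where "S3 = {p. prime p \<and> N < p * p \<and> p \<le> N \<and> N < 4 * p}"
  have "C > 0" unfolding C_def by simp
  have q_le: "q p \<le> N" if "prime p" for p
    unfolding q_def C_def using assms that by (intro prime_power_dvd_binomial_le) auto
  have q_le': "q p \<le> p" if "prime p" "N < p * p" for p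
  proof -
    have "p ^ multiplicity p C < p ^ 2"
      using q_le[OF that(1)] that(2) unfolding q_def by (simp add: power2_eq_square)
    then have "multiplicity p C < 2"
      using that(1) by (meson prime_gt_1_nat power_less_imp_less_exp)
    then show ?thesis unfolding q_def using that(1)
      by (metis less_2_cases power_0 One_nat_def power_one_right prime_ge_1_nat order_refl)
  qed
  have fin: "finite S" unfolding S_def by auto
  have "p \<le> N \<longleftrightarrow> p * p \<le> N \<or> (N < p * p \<and> 4 * p \<le> N) \<or> (N < p * p \<and> p \<le> N \<and> N < 4 * p)" for p
    using le_square[of p] by linarith
  then have S: "S = S1 \<union> (S2 \<union> S3)"
    unfolding S_def S1_def S2_def S3_def by blast
  have "prime_factors C \<subseteq> S"
  proof
    fix p assume p: "p \<in> prime_factors C"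
    then have "prime p" "multiplicity p C > 0"
      by (simp_all add: prime_factors_multiplicity)
    then have "p ^ 1 \<le> q p" unfolding q_def
      by (intro power_increasing) (simp_all add: prime_ge_Suc_0_nat)
    with \<open>prime p\<close> show "p \<in> S" unfolding S_def using q_le[of p] by simp
  qed
  have "C = (\<Prod>p\<in>prime_factors C. q p)"
    unfolding q_def using prod_prime_factors[of C] \<open>C > 0\<close> by simp
  also have "\<dots> = (\<Prod>p\<in>S. q p)"
    using \<open>prime_factors C \<subseteq> S\<close> fin unfolding q_def S_def
    by (intro prod.mono_neutral_left) (auto simp: prime_factors_multiplicity)
  also have "\<dots> = prod q S1 * (prod q S2 * prod q S3)"
  proof -
    have "finite S1" "finite S2" "finite S3" using fin unfolding S by auto
    moreover have "S2 \<inter> S3 = {}" "S1 \<inter> (S2 \<union> S3) = {}"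
      by (auto simp: S1_def S2_def S3_def)
    ultimately show ?thesis unfolding S by (simp add: prod.union_disjoint)
  qed
  finally have C: "C = prod q S1 * prod q S2 * prod q S3" by simp
  have "prod q S1 \<le> (\<Prod>p\<in>S1. N)"
    using q_le by (intro prod_mono) (auto simp: S1_def)
  then have 1: "prod q S1 \<le> N ^ card S1" by simp
  have "prod q S2 \<le> \<Prod>S2"
    using q_le' by (intro prod_mono) (auto simp: S2_def)
  also have "\<dots> \<le> \<Prod>{p. prime p \<and> p \<le> N div 4}"
  proof (intro dvd_imp_le prod_dvd_prod_subset)
    show "S2 \<subseteq> {p. prime p \<and> p \<le> N div 4}" by (auto simp: S2_def)
  qed (auto simp: prime_gt_0_nat intro!: prod_pos)
  also have "\<dots> \<le> 4 ^ (N div 4)" by (rule primorial_le)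
  finally have 2: "prod q S2 \<le> 4 ^ (N div 4)" .
  have "prod q S3 \<le> (\<Prod>p\<in>S3. N)"
    using q_le by (intro prod_mono) (auto simp: S3_def)
  also have "\<dots> = N ^ card S3" by simp
  also have "\<dots> \<le> N ^ card {p. prime p \<and> p \<le> N \<and> N < 4 * p}"
    using assms by (intro power_increasing card_mono) (auto simp: S3_def)
  finally have 3: "prod q S3 \<le> N ^ card {p. prime p \<and> p \<le> N \<and> N < 4 * p}" .
  have "C \<le> N ^ card S1 * 4 ^ (N div 4) * N ^ card {p. prime p \<and> p \<le> N \<and> N < 4 * p}"
    unfolding C by (intro mult_le_mono 1 2 3)
  then have "(N + 1) * C \<le> (N + 1) * (N ^ card S1 * 4 ^ (N div 4)
      * N ^ card {p. prime p \<and> p \<le> N \<and> N < 4 * p})"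
    by (rule mult_le_mono2)
  with central_binomial_ge[of N] show ?thesis unfolding C_def S1_def by (rule le_trans)
qed

lemma card_primes_block_ge:
  "eventually (\<lambda>N. real N / (4 * ln (real N)) \<le> real (card {p. prime p \<and> p \<le> N \<and> N < 4 * p}))
     sequentially"
proof -
  \<comment> \<open>After logarithms, \<open>N * ln 2 / 2\<close> remains for the block, and this is
    at least \<open>N / 3\<close> because \<open>ln 2 \<ge> 2 / 3\<close>. The gap between
    \<open>N / 3\<close> and \<open>N / 4\<close> absorbs the two error terms.\<close>
  have "eventually (\<lambda>N. real N / 4 + ln (real N + 1) + sqrt (real N) * ln (real N)
      \<le> real N / 3) sequentially"
    by real_asymp
  then show ?thesis
    using eventually_ge_at_top[of 2]
  proof eventually_elim
    case (elim N)
    let ?c = "card {p. prime p \<and> p \<le> N \<and> N < 4 * p}"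
    let ?s = "card {p::nat. prime p \<and> p * p \<le> N}"
    have "real ?s \<le> sqrt (real N)"
    proof -
      have "p \<le> nat \<lfloor>sqrt (real N)\<rfloor>" if "p * p \<le> N" for p :: nat
        using that by (simp add: le_nat_floor real_le_rsqrt power2_eq_square flip: of_nat_mult)
      then have "{p::nat. prime p \<and> p * p \<le> N} \<subseteq> {1..nat \<lfloor>sqrt (real N)\<rfloor>}"
        by (auto simp: prime_ge_1_nat Suc_leI prime_gt_0_nat)
      then have "?s \<le> nat \<lfloor>sqrt (real N)\<rfloor>"
        using card_mono[of "{1..nat \<lfloor>sqrt (real N)\<rfloor>}"] by simp
      moreover have "real (nat \<lfloor>sqrt (real N)\<rfloor>) \<le> sqrt (real N)"
        by (intro of_nat_floor) auto
      ultimately show ?thesis by (meson of_nat_mono order_trans)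
    qed
    have pos: "0 < ln (real N)" using elim by simp
    have "real (2 ^ N) \<le> real ((N + 1) * (N ^ ?s * 4 ^ (N div 4) * N ^ ?c))"
      using prime_counting_ineq[of N] elim by (simp only: of_nat_le_iff)
    then have "2 ^ N \<le> (real N + 1) * (real N ^ ?s * 4 ^ (N div 4) * real N ^ ?c)"
      by (simp only: of_nat_mult of_nat_add of_nat_power of_nat_1 of_nat_numeral)
    then have "ln (2 ^ N) \<le> ln ((real N + 1) * (real N ^ ?s * 4 ^ (N div 4) * real N ^ ?c))"
      by (intro ln_mono) auto
    also have "\<dots> = ln (real N + 1)
        + (ln (real N ^ ?s) + ln (4 ^ (N div 4)) + ln (real N ^ ?c))"
    proof -
      have "ln (a * (b * c * d)) = ln a + (ln b + ln c + ln d)"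
        if "a > 0" "b > 0" "c > 0" "d > 0" for a b c d :: real
        using that by (simp add: ln_mult_pos)
      moreover have "real N + 1 > 0" "real N > 0" using elim by auto
      ultimately show ?thesis by (simp only: zero_less_power zero_less_numeral)
    qed
    finally have "real N * ln 2 \<le> ln (real N + 1)
        + (real ?s * ln (real N) + real (N div 4) * ln 4 + real ?c * ln (real N))"
      by (simp only: ln_realpow)
    moreover have "real (N div 4) * ln 4 \<le> real N / 4 * ln 4"
      by (intro mult_right_mono) auto
    moreover have "real N / 4 * ln 4 = real N * ln 2 / 2"
      using ln_realpow[of 2 2] by simp
    moreover have "real ?s * ln (real N) \<le> sqrt (real N) * ln (real N)"
      using \<open>real ?s \<le> sqrt (real N)\<close> pos by (intro mult_right_mono) auto
    moreover have "real N * (2 / 3) \<le> real N * ln 2"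
      by (intro mult_left_mono ln2_ge_two_thirds) auto
    ultimately have "real N / 4 \<le> real ?c * ln (real N)"
      using elim by linarith
    then show ?case using pos by (simp add: field_simps)
  qed
qed

subsection \<open>Combining subset sums over large primes\<close>

text \<open>The set \<open>A\<close> is the support of \<open>t\<close>. Different sets may have
  equal sums (1/2 = 1/3 + 1/6), so the cardinality is not simply \<open>2 ^ N\<close>.\<close>

lemma egyptian_sums_eq_image:
  "egyptian_sums N = (\<lambda>A. \<Sum>n\<in>A. 1 / of_nat n) ` Pow {1..N}"
proof (intro equalityI subsetI)
  fix x assume "x \<in> egyptian_sums N"
  then obtain t :: "nat \<Rightarrow> rat" where t: "\<forall>n\<in>{1..N}. t n \<in> {0, 1}" and x: "x = (\<Sum>n=1..N. t n / of_nat n)"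
    unfolding egyptian_sums_def by auto
  have "x = (\<Sum>n\<in>{n\<in>{1..N}. t n = 1}. 1 / of_nat n)"
    unfolding x using t by (intro sum.mono_neutral_cong_right) auto
  then show "x \<in> (\<lambda>A. \<Sum>n\<in>A. 1 / of_nat n) ` Pow {1..N}" by auto
next
  fix x :: rat assume "x \<in> (\<lambda>A. \<Sum>n\<in>A. 1 / of_nat n) ` Pow {1..N}"
  then obtain A where A: "A \<subseteq> {1..N}" and x: "x = (\<Sum>n\<in>A. 1 / of_nat n)" by auto
  have "x = (\<Sum>n=1..N. (if n \<in> A then 1 else 0) / of_nat n)"
    unfolding x using A by (intro sum.mono_neutral_cong_left) auto
  then show "x \<in> egyptian_sums N" unfolding egyptian_sums_def by fastforce
qed

lemma finite_egyptian_sums: "finite (egyptian_sums N)"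
  unfolding egyptian_sums_eq_image by simp

lemma card_egyptian_sums_ge_2:
  assumes "N \<ge> 1"
  shows "card (egyptian_sums N) \<ge> 2"
proof -
  have "0 \<in> egyptian_sums N"
    unfolding egyptian_sums_eq_image by (rule image_eqI[of _ _ "{}"]) auto
  moreover have "1 \<in> egyptian_sums N"
    unfolding egyptian_sums_eq_image using assms by (intro image_eqI[of _ _ "{1}"]) auto
  ultimately have "card {0, 1 :: rat} \<le> card (egyptian_sums N)"
    by (intro card_mono finite_egyptian_sums) auto
  then show ?thesis by simp
qed

text \<open>The denominator depends on \<open>M\<close> alone, so it serves all
  \<open>m \<le> M\<close> at once; the numerator has at most \<open>M\<close> terms, each at most
  \<open>fact M\<close>.\<close>

lemma egyptian_sums_common_denominator:
  assumes "x \<in> egyptian_sums m" "m \<le> M"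
  obtains a :: nat where "x = of_nat a / of_nat (fact M)" "a \<le> M * fact M"
proof -
  obtain A where A: "A \<subseteq> {1..m}" and x: "x = (\<Sum>n\<in>A. 1 / of_nat n)"
    using assms unfolding egyptian_sums_eq_image by auto
  define a :: nat where "a = (\<Sum>n\<in>A. fact M div n)"
  have "of_nat (fact M div n) = (of_nat (fact M) :: rat) / of_nat n" if "n \<in> A" for n
  proof -
    have "n dvd fact M" using that A assms by (intro dvd_fact) auto
    moreover have "n > 0" using that A by auto
    ultimately show ?thesis by (auto elim!: dvdE simp del: of_nat_fact)
  qed
  then have "of_nat a = (\<Sum>n\<in>A. (of_nat (fact M) :: rat) / of_nat n)"
    unfolding a_def by simp
  then have "x = of_nat a / of_nat (fact M)"
    unfolding x by (simp add: sum_divide_distrib)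
  moreover have "a \<le> (\<Sum>n\<in>{1..M}. fact M)"
    unfolding a_def using A assms by (intro order_trans[OF sum_mono sum_mono2]) auto
  ultimately show ?thesis using that by simp
qed

text \<open>After multiplication by the product of \<open>P\<close>, every term but that of
  \<open>q\<close> is divisible by \<open>q\<close>, while the cofactor of \<open>d q\<close> is
  not. So \<open>q\<close> divides \<open>d q\<close>, which is too small to be a nonzero
  multiple.\<close>

lemma sum_prime_fractions_eq_0D:
  fixes d :: "nat \<Rightarrow> int"
  assumes "finite P" and P: "\<And>p. p \<in> P \<Longrightarrow> prime p \<and> \<bar>d p\<bar> < int p"
    and sum0: "(\<Sum>p\<in>P. of_int (d p) / of_nat p) = (0 :: rat)" and q: "q \<in> P"
  shows "d q = 0"
proof -
  have nz: "p \<noteq> 0" if "p \<in> P" for p using P[OF that] by auto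
  have "of_int (\<Sum>p\<in>P. d p * int (\<Prod>(P - {p}))) = (\<Sum>p\<in>P. of_int (d p) / of_nat p * of_nat (\<Prod>P) :: rat)"
    unfolding of_int_sum
  proof (rule sum.cong)
    fix p assume p: "p \<in> P"
    have "\<Prod>P = p * \<Prod>(P - {p})" using assms(1) p by (rule prod.remove)
    then show "of_int (d p * int (\<Prod>(P - {p}))) = (of_int (d p) / of_nat p * of_nat (\<Prod>P) :: rat)"
      using nz[OF p] by (simp del: of_nat_prod)
  qed simp
  also have "\<dots> = 0" by (simp only: sum_distrib_right[symmetric] sum0 mult_zero_left)
  finally have "(\<Sum>p\<in>P. d p * int (\<Prod>(P - {p}))) = 0" by (simp only: of_int_eq_0_iff)
  then have "d q * int (\<Prod>(P - {q})) = - (\<Sum>p\<in>P - {q}. d p * int (\<Prod>(P - {p})))"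
    using sum.remove[OF assms(1) q, of "\<lambda>p. d p * int (\<Prod>(P - {p}))"] by linarith
  moreover have "int q dvd (\<Sum>p\<in>P - {q}. d p * int (\<Prod>(P - {p})))"
  proof (intro dvd_sum dvd_mult)
    fix p assume "p \<in> P - {q}"
    then have "q dvd \<Prod>(P - {p})" using assms(1) q by (intro dvd_prodI) auto
    then show "int q dvd int (\<Prod>(P - {p}))" by (simp only: of_nat_dvd_iff)
  qed
  ultimately have "int q dvd d q * int (\<Prod>(P - {q}))" by simp
  moreover have "\<not> int q dvd int (\<Prod>(P - {q}))"
  proof
    assume "int q dvd int (\<Prod>(P - {q}))"
    then have "q dvd \<Prod>(P - {q})" by (simp only: of_nat_dvd_iff)
    then obtain p where "p \<in> P - {q}" "q dvd p"
      using assms(1) P[OF q] by (auto simp: prime_dvd_prod_iff)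
    then show False using P[OF q] P[of p] primes_dvd_imp_eq by blast
  qed
  moreover have "prime (int q)" using P[OF q] by simp
  ultimately have "int q dvd d q" by (blast dest: prime_dvd_multD)
  show ?thesis
  proof (rule ccontr)
    assume "d q \<noteq> 0"
    then have "\<bar>int q\<bar> \<le> \<bar>d q\<bar>" using \<open>int q dvd d q\<close> by (rule dvd_imp_le_int)
    then show False using P[OF q] by linarith
  qed
qed

text \<open>The map \<open>S\<close> is injective by the preceding lemma, applied to differences of
  numerators over \<open>fact M\<close>. Its values are subset sums for \<open>N\<close>, because
  dividing by \<open>p\<close> moves the denominators of \<open>e p\<close> to multiples of
  \<open>p\<close>, and these sets are disjoint for different primes.\<close>

lemma prod_card_egyptian_sums_le:
  assumes "finite P"
    and P: "\<And>p. p \<in> P \<Longrightarrow> prime p \<and> M * fact M < p \<and> N div p \<le> M"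
  shows "(\<Prod>p\<in>P. card (egyptian_sums (N div p))) \<le> card (egyptian_sums N)"
proof -
  define S where "S e = (\<Sum>p\<in>P. e p / of_nat p)" for e :: "nat \<Rightarrow> rat"
  let ?E = "\<Pi>\<^sub>E p\<in>P. egyptian_sums (N div p)"
  have pos: "p > 0" if "p \<in> P" for p using P[OF that] by auto
  have "inj_on S ?E"
  proof (rule inj_onI)
    fix e e' assume e: "e \<in> ?E" and e': "e' \<in> ?E" and eq: "S e = S e'"
    have ex: "\<exists>a. f p = of_nat a / of_nat (fact M) \<and> a \<le> M * fact M"
      if f: "f \<in> ?E" and p: "p \<in> P" for f p
    proof -
      have "f p \<in> egyptian_sums (N div p)" using f p by (rule PiE_mem)
      then show ?thesis using P[OF p] egyptian_sums_common_denominator by blast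
    qed
    obtain a where a: "\<And>p. p \<in> P \<Longrightarrow> e p = of_nat (a p) / of_nat (fact M) \<and> a p \<le> M * fact M"
      using ex[OF e] by metis
    obtain a' where a': "\<And>p. p \<in> P \<Longrightarrow> e' p = of_nat (a' p) / of_nat (fact M) \<and> a' p \<le> M * fact M"
      using ex[OF e'] by metis
    define d where "d p = int (a p) - int (a' p)" for p
    have "(\<Sum>p\<in>P. of_int (d p) / of_nat p) = (\<Sum>p\<in>P. of_nat (fact M) * (e p / of_nat p - e' p / of_nat p))"
      using a a' by (intro sum.cong) (auto simp: d_def diff_divide_distrib right_diff_distrib)
    also have "\<dots> = of_nat (fact M) * (S e - S e')"
      unfolding S_def by (simp add: sum_distrib_left sum_subtractf right_diff_distrib)
    finally have sum0: "(\<Sum>p\<in>P. of_int (d p) / of_nat p) = (0 :: rat)" using eq by simp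
    \<comment> \<open>Both numerators lie between 0 and \<open>M * fact M\<close>, which is below
      \<open>p\<close>, hence so does the size of their difference.\<close>
    have d: "prime p \<and> \<bar>d p\<bar> < int p" if "p \<in> P" for p
      using P[OF that] a[OF that] a'[OF that] unfolding d_def by linarith
    have "a p = a' p" if "p \<in> P" for p
      using sum_prime_fractions_eq_0D[OF assms(1) d sum0 that] unfolding d_def by simp
    then show "e = e'" using a a' by (intro PiE_ext[OF e e']) simp
  qed
  moreover have "S ` ?E \<subseteq> egyptian_sums N"
  proof
    fix x assume "x \<in> S ` ?E"
    then obtain e where e: "e \<in> ?E" and x: "x = S e" by auto
    have "\<forall>p\<in>P. \<exists>A. A \<subseteq> {1..N div p} \<and> e p = (\<Sum>n\<in>A. 1 / of_nat n)"
      using PiE_mem[OF e] unfolding egyptian_sums_eq_image by auto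
    then obtain A where A: "\<And>p. p \<in> P \<Longrightarrow> A p \<subseteq> {1..N div p} \<and> e p = (\<Sum>n\<in>A p. 1 / of_nat n)"
      by metis
    \<comment> \<open>A common denominator \<open>p * m = q * n\<close> would make \<open>p\<close>
      divide \<open>n\<close>, but \<open>n \<le> M < p\<close>.\<close>
    have disj: "(*) p ` A p \<inter> (*) q ` A q = {}" if "p \<in> P" "q \<in> P" "p \<noteq> q" for p q
    proof (rule ccontr)
      assume "(*) p ` A p \<inter> (*) q ` A q \<noteq> {}"
      then obtain m n where mn: "m \<in> A p" "n \<in> A q" "p * m = q * n" by auto
      then have "p dvd q * n" by (metis dvd_triv_left)
      moreover have "\<not> p dvd q"
        using that P[OF that(1)] P[OF that(2)] primes_dvd_imp_eq by blast
      ultimately have "p dvd n"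
        using P[OF that(1)] by (simp add: prime_dvd_mult_iff)
      moreover have "1 \<le> n" "n \<le> M" using mn A[OF that(2)] P[OF that(2)] by auto
      ultimately have "p \<le> M" by (auto dest: dvd_imp_le)
      also have "M \<le> M * fact M" by simp
      finally show False using P[OF that(1)] by simp
    qed
    have "e p / of_nat p = (\<Sum>n\<in>(*) p ` A p. 1 / of_nat n)" if "p \<in> P" for p
      using A[OF that] pos[OF that]
      by (subst sum.reindex) (auto simp: inj_on_def sum_divide_distrib mult.commute)
    then have "x = (\<Sum>p\<in>P. \<Sum>n\<in>(*) p ` A p. 1 / of_nat n)"
      unfolding x S_def by simp
    also have "\<dots> = (\<Sum>n\<in>(\<Union>p\<in>P. (*) p ` A p). 1 / of_nat n)"
      using assms(1) A disj
      by (intro sum.UNION_disjoint[symmetric]) (auto intro: finite_subset)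
    finally have "x = (\<Sum>n\<in>(\<Union>p\<in>P. (*) p ` A p). 1 / of_nat n)" .
    moreover have "p * n \<in> {1..N}" if "p \<in> P" "n \<in> A p" for p n
    proof -
      have "1 \<le> n" "n \<le> N div p" using A[OF that(1)] that(2) by auto
      then show ?thesis using pos[OF that(1)]
        by (auto simp: less_eq_div_iff_mult_less_eq mult.commute)
    qed
    then have "(\<Union>p\<in>P. (*) p ` A p) \<in> Pow {1..N}" by blast
    ultimately show "x \<in> egyptian_sums N" unfolding egyptian_sums_eq_image by blast
  qed
  ultimately have "card ?E \<le> card (egyptian_sums N)"
    using finite_egyptian_sums by (rule card_inj_on_le)
  then show ?thesis using assms(1) by (simp add: card_PiE)
qed

section \<open>Logarithmic counts over dyadic blocks of primes\<close>

definition log_card_egyptian :: "nat \<Rightarrow> real" where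
  "log_card_egyptian N = ln (real (card (egyptian_sums N)))"

lemma log_card_egyptian_mono:
  assumes "M \<le> N"
  shows "log_card_egyptian M \<le> log_card_egyptian N"
proof -
  have "egyptian_sums M \<subseteq> egyptian_sums N"
    unfolding egyptian_sums_eq_image using assms by (intro image_mono Pow_mono) auto
  then have "card (egyptian_sums M) \<le> card (egyptian_sums N)"
    by (intro card_mono finite_egyptian_sums)
  moreover have "card (egyptian_sums M) > 0"
    unfolding card_gt_0_iff egyptian_sums_eq_image by auto
  ultimately show ?thesis unfolding log_card_egyptian_def by (intro ln_mono) auto
qed

lemma log_card_egyptian_ge_ln2:
  assumes "N \<ge> 1"
  shows "log_card_egyptian N \<ge> ln 2"
  unfolding log_card_egyptian_def using card_egyptian_sums_ge_2[OF assms] by (intro ln_mono) auto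

lemma log_card_egyptian_nonneg: "log_card_egyptian N \<ge> 0"
proof -
  have "log_card_egyptian 0 = 0"
    unfolding log_card_egyptian_def egyptian_sums_eq_image by simp
  then show ?thesis using log_card_egyptian_mono[of 0 N] by simp
qed

lemma sum_log_card_egyptian_le:
  assumes "finite P"
    and P: "\<And>p. p \<in> P \<Longrightarrow> prime p \<and> M * fact M < p \<and> p \<le> N \<and> N div p \<le> M"
  shows "(\<Sum>p\<in>P. log_card_egyptian (N div p)) \<le> log_card_egyptian N"
proof -
  have pos: "0 < real (card (egyptian_sums (N div p)))" if "p \<in> P" for p
  proof -
    have "p > 0" "p \<le> N" using P[OF that] by auto
    then have "N div p \<ge> 1" by (simp add: div_greater_zero_iff Suc_le_eq)
    from card_egyptian_sums_ge_2[OF this] show ?thesis by simp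
  qed
  have "(\<Sum>p\<in>P. log_card_egyptian (N div p)) = ln (\<Prod>p\<in>P. real (card (egyptian_sums (N div p))))"
    unfolding log_card_egyptian_def using pos by (intro ln_prod[symmetric] assms(1)) auto
  also have "\<dots> \<le> ln (real (card (egyptian_sums N)))"
  proof (rule ln_mono)
    show "0 < (\<Prod>p\<in>P. real (card (egyptian_sums (N div p))))" using pos by (rule prod_pos)
    have "(\<Prod>p\<in>P. card (egyptian_sums (N div p))) \<le> card (egyptian_sums N)"
      using P by (intro prod_card_egyptian_sums_le[of P M] assms(1)) auto
    then show "(\<Prod>p\<in>P. real (card (egyptian_sums (N div p)))) \<le> real (card (egyptian_sums N))"
      by (simp only: of_nat_prod[symmetric] of_nat_le_iff)
  qed
  finally show ?thesis unfolding log_card_egyptian_def .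
qed

text \<open>On the \<open>i\<close>-th block, \<open>N div p\<close> lies in [4^i, 4^(i+1)), so
  blocks are disjoint and monotonicity replaces \<open>N div p\<close> by \<open>4 ^ i\<close>.
  Hypothesis \<open>I\<close> keeps \<open>N div p\<close> below \<open>M\<close>, and hypothesis
  \<open>M\<close> then forces every such prime above \<open>M * fact M\<close>.\<close>

lemma log_card_egyptian_ge_block_sum:
  assumes M: "(M + 1) * (M * fact M) \<le> N" and I: "4 ^ (I + 1) \<le> M"
  shows "(\<Sum>i=1..I. real (card {p. prime p \<and> p \<le> N div 4 ^ i \<and> N div 4 ^ i < 4 * p}) * log_card_egyptian (4 ^ i))
           \<le> log_card_egyptian N"
proof -
  define P where "P i = {p::nat. prime p \<and> p \<le> N div 4 ^ i \<and> N div 4 ^ i < 4 * p}" for i :: nat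
  have fin: "finite (P i)" for i unfolding P_def by (rule finite_subset[of _ "{..N div 4 ^ i}"]) auto
  have div: "4 ^ i \<le> N div p" "N div p < 4 ^ (i + 1)" if "p \<in> P i" for i p
  proof -
    have p: "p > 0" "p \<le> N div 4 ^ i" "N div 4 ^ i < 4 * p"
      using that by (auto simp: P_def prime_gt_0_nat)
    then show "4 ^ i \<le> N div p"
      by (simp add: less_eq_div_iff_mult_less_eq mult.commute)
    have "N < 4 * p * 4 ^ i" using p(3) by (subst (asm) div_less_iff_less_mult) auto
    then show "N div p < 4 ^ (i + 1)"
      using p(1) by (subst div_less_iff_less_mult) (auto simp: mult_ac)
  qed
  have disj: "P i \<inter> P j = {}" if "i < j" for i j
  proof (rule ccontr)
    assume "P i \<inter> P j \<noteq> {}"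
    then obtain p where "p \<in> P i" "p \<in> P j" by auto
    then have "4 ^ j < (4 :: nat) ^ (i + 1)" using div[of p i] div[of p j] by linarith
    moreover have "(4 :: nat) ^ (i + 1) \<le> 4 ^ j" using that by (intro power_increasing) auto
    ultimately show False by linarith
  qed
  have "(\<Sum>i=1..I. real (card (P i)) * log_card_egyptian (4 ^ i)) = (\<Sum>i=1..I. \<Sum>p\<in>P i. log_card_egyptian (4 ^ i))"
    by simp
  also have "\<dots> \<le> (\<Sum>i=1..I. \<Sum>p\<in>P i. log_card_egyptian (N div p))"
    by (intro sum_mono log_card_egyptian_mono div)
  also have "\<dots> = (\<Sum>p\<in>(\<Union>i\<in>{1..I}. P i). log_card_egyptian (N div p))"
  proof (rule sum.UNION_disjoint[symmetric])
    show "\<forall>i\<in>{1..I}. \<forall>j\<in>{1..I}. i \<noteq> j \<longrightarrow> P i \<inter> P j = {}"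
      using disj by (metis Int_commute linorder_neqE_nat)
  qed (auto simp: fin)
  also have "\<dots> \<le> log_card_egyptian N"
  proof (rule sum_log_card_egyptian_le)
    fix p assume "p \<in> (\<Union>i\<in>{1..I}. P i)"
    then obtain i where i: "i \<le> I" "p \<in> P i" by auto
    have "prime p" "p \<le> N div 4 ^ i" using i by (auto simp: P_def)
    then have "p > 0" "p \<le> N"
      using div_le_dividend[of N "4 ^ i"] by (simp_all add: prime_gt_0_nat del: div_le_dividend)
    have "(4 :: nat) ^ (i + 1) \<le> 4 ^ (I + 1)" using i by (intro power_increasing) auto
    then have "N div p < M" using div(2)[OF i(2)] I by linarith
    then have "N < M * p" using \<open>p > 0\<close> by (simp add: div_less_iff_less_mult)
    have "M * fact M < p"
    proof (rule ccontr)
      assume "\<not> M * fact M < p"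
      then have "M * p \<le> (M + 1) * (M * fact M)" by (intro mult_le_mono) auto
      then show False using M \<open>N < M * p\<close> by linarith
    qed
    then show "prime p \<and> M * fact M < p \<and> p \<le> N \<and> N div p \<le> M"
      using \<open>prime p\<close> \<open>p \<le> N\<close> \<open>N div p < M\<close> by simp
  qed (auto simp: fin)
  finally show ?thesis unfolding P_def .
qed

text \<open>The block bound with \<open>M\<close> the floor of \<open>sqrt (ln N)\<close> and
  Chebyshev's estimate for each block. The quantifier over \<open>I\<close> is inside, so that
  \<open>I\<close> may depend on \<open>N\<close>.\<close>

lemma log_card_egyptian_ge_dyadic_sum:
  "eventually (\<lambda>N. \<forall>I. 4 ^ (I + 1) \<le> sqrt (ln (real N)) \<longrightarrow>
      real N / (8 * ln (real N)) * (\<Sum>i=1..I. log_card_egyptian (4 ^ i) / 4 ^ i) \<le> log_card_egyptian N)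
     sequentially"
proof -
  obtain X where X: "\<And>n. n \<ge> X \<Longrightarrow>
      real n / (4 * ln (real n)) \<le> real (card {p. prime p \<and> p \<le> n \<and> n < 4 * p})"
    using card_primes_block_ge unfolding eventually_sequentially by auto
  \<comment> \<open>This dominates \<open>(M + 1) * (M * fact M)\<close>, by
    \<open>fact M \<le> M ^ M\<close> and \<open>M \<le> sqrt (ln N)\<close>.\<close>
  have "eventually (\<lambda>N. (sqrt (ln (real N)) + 1) powr (sqrt (ln (real N)) + 2) \<le> real N) sequentially"
    by real_asymp
  \<comment> \<open>Since \<open>4 ^ i \<le> sqrt (ln N)\<close>, this puts every
    \<open>N div 4 ^ i\<close> beyond Chebyshev's threshold \<open>X\<close>; the 3 also covers
    rounding.\<close>
  moreover have "eventually (\<lambda>N. real N / sqrt (ln (real N)) \<ge> real X + 3) sequentially"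
    by real_asymp
  moreover have "eventually (\<lambda>N. sqrt (ln (real N)) \<ge> 1) sequentially"
    by real_asymp
  ultimately show ?thesis
    using eventually_ge_at_top[of 3]
  proof eventually_elim
    case (elim N)
    define s where "s = sqrt (ln (real N))"
    define M where "M = nat \<lfloor>s\<rfloor>"
    have "s \<ge> 1" "N > 0" using elim by (auto simp: s_def)
    have Ms: "real M \<le> s" unfolding M_def using \<open>s \<ge> 1\<close> by (intro of_nat_floor) auto
    have "real ((M + 1) * (M * fact M)) \<le> (s + 1) * (s * s ^ M)"
    proof -
      have "real (fact M) \<le> s ^ M"
        using fact_le_power[of M, where 'a = real] Ms power_mono[of "real M" s M] by simp
      then show ?thesis using Ms unfolding of_nat_mult by (intro mult_mono) auto
    qed
    also have "\<dots> \<le> (s + 1) ^ (M + 2)"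
      using \<open>s \<ge> 1\<close> by (auto simp: power_add power2_eq_square mult.assoc intro!: mult_mono power_mono)
    also have "\<dots> = (s + 1) powr (real M + 2)"
      using \<open>s \<ge> 1\<close> powr_realpow[of "s + 1" "M + 2"] by (simp add: add.commute)
    also have "\<dots> \<le> (s + 1) powr (s + 2)" using \<open>s \<ge> 1\<close> Ms by (intro powr_mono) auto
    also have "\<dots> \<le> real N" using elim by (simp add: s_def)
    finally have M: "(M + 1) * (M * fact M) \<le> N" by (simp only: of_nat_le_iff)
    show ?case
    proof (intro allI impI)
      fix I :: nat assume I: "4 ^ (I + 1) \<le> sqrt (ln (real N))"
      then have "4 ^ (I + 1) \<le> M" unfolding M_def s_def by (simp add: le_nat_floor)
      note block = log_card_egyptian_ge_block_sum[OF M this]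
      have "real N / (8 * ln (real N)) * (\<Sum>i=1..I. log_card_egyptian (4 ^ i) / 4 ^ i)
          = (\<Sum>i=1..I. real N / (8 * ln (real N) * 4 ^ i) * log_card_egyptian (4 ^ i))"
        by (simp add: sum_distrib_left)
      also have "\<dots> \<le> (\<Sum>i=1..I. real (card {p. prime p \<and> p \<le> N div 4 ^ i \<and> N div 4 ^ i < 4 * p})
          * log_card_egyptian (4 ^ i))"
      proof (intro sum_mono mult_right_mono log_card_egyptian_nonneg)
        fix i assume "i \<in> {1..I}"
        define n where "n = N div 4 ^ i"
        have "(4 :: real) ^ i \<le> 4 ^ (I + 1)" using \<open>i \<in> {1..I}\<close> by (intro power_increasing) auto
        then have "(4 :: real) ^ i \<le> s" using I by (simp add: s_def)
        then have "real N / s \<le> real N / 4 ^ i" using \<open>s \<ge> 1\<close> by (intro divide_left_mono) auto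
        then have big: "real X + 3 \<le> real N / 4 ^ i" using elim by (simp add: s_def)
        have "N < 4 ^ i * (n + 1)" unfolding n_def using dividend_less_times_div[of "4 ^ i" N] by simp
        then have "real N < real (4 ^ i * (n + 1))" by (simp only: of_nat_less_iff)
        then have "real N / 4 ^ i < real n + 1" by (simp add: divide_less_eq algebra_simps)
        then have "n \<ge> X" "n \<ge> 2" using big by linarith+
        \<comment> \<open>Rounding down loses less than 1 from a number that is at least 3. This
          factor 2 turns Chebyshev's 4 into the 8 of the statement.\<close>
        have "real n \<ge> real N / 4 ^ i / 2"
          using big \<open>real N / 4 ^ i < real n + 1\<close> by (simp only: divide_le_eq_numeral1)
        have "n \<le> N" unfolding n_def by simp
        then have "0 < ln (real n)" "ln (real n) \<le> ln (real N)" using \<open>n \<ge> 2\<close> by auto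
        have "real N / (8 * ln (real N) * 4 ^ i) = (real N / 4 ^ i / 2) / (4 * ln (real N))"
          by simp
        also have "\<dots> \<le> real n / (4 * ln (real n))"
          using \<open>0 < ln (real n)\<close> \<open>ln (real n) \<le> ln (real N)\<close> \<open>real n \<ge> real N / 4 ^ i / 2\<close>
          by (intro frac_le) auto
        also have "\<dots> \<le> real (card {p. prime p \<and> p \<le> n \<and> n < 4 * p})"
          using \<open>n \<ge> X\<close> by (rule X)
        finally show "real N / (8 * ln (real N) * 4 ^ i)
            \<le> real (card {p. prime p \<and> p \<le> N div 4 ^ i \<and> N div 4 ^ i < 4 * p})"
          unfolding n_def .
      qed
      also note block
      finally show "real N / (8 * ln (real N)) * (\<Sum>i=1..I. log_card_egyptian (4 ^ i) / 4 ^ i)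
          \<le> log_card_egyptian N" .
    qed
  qed
qed

subsection \<open>Induction on the number of iterated logarithms\<close>

lemma filterlim_iter_log: "filterlim (iter_log j) at_top at_top"
proof (induction j)
  case (Suc j)
  then show ?case by (simp add: filterlim_compose[OF ln_at_top])
qed (simp add: filterlim_ident)

lemma eventually_iter_log_ge: "eventually (\<lambda>N. iter_log j (real N) \<ge> c) sequentially"
  using filterlim_compose[OF filterlim_iter_log filterlim_real_sequentially]
  by (auto simp: filterlim_at_top)

text \<open>The square root halves one logarithm; the next logarithm makes this an additive loss, so
  at \<open>j = 3\<close> half of the target remains. Later logarithms preserve the factor 1/2.
  Uniformity in \<open>x\<close> allows all \<open>x = 4 ^ i\<close> to be treated at once.\<close>

lemma iter_log_ge_half:
  assumes "j \<ge> 3"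
  shows "eventually (\<lambda>N. \<forall>x \<ge> exp (sqrt (ln (ln (real N)) / 8)).
           iter_log j x \<ge> iter_log (Suc j) (real N) / 2) sequentially"
  using assms
proof (induction j rule: dec_induct)
  case base
  have "eventually (\<lambda>N. ln (ln (real N)) / 8 > 0) sequentially" by real_asymp
  moreover have "eventually (\<lambda>N. ln (ln (ln (real N)) / 8) > 0) sequentially" by real_asymp
  moreover have "eventually (\<lambda>N. ln (ln (ln (ln (real N)) / 8) / 2) \<ge> ln (ln (ln (ln (real N)))) / 2) sequentially"
    by real_asymp
  ultimately show ?case
  proof eventually_elim
    case (elim N)
    define Y where "Y = ln (ln (real N)) / 8"
    show ?case
    proof (intro allI impI)
      fix x assume "x \<ge> exp (sqrt (ln (ln (real N)) / 8))"
      then have x: "x \<ge> exp (sqrt Y)" by (simp add: Y_def)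
      have Y: "Y > 0" "ln Y > 0" using elim by (simp_all add: Y_def)
      have "ln x \<ge> sqrt Y" using x ln_mono[of "exp (sqrt Y)" x] by simp
      then have "ln (ln x) \<ge> ln (sqrt Y)" using Y by (intro ln_mono) auto
      then have "ln (ln x) \<ge> ln Y / 2" using Y by (simp add: ln_sqrt)
      then have "ln (ln (ln x)) \<ge> ln (ln Y / 2)" using Y by (intro ln_mono) auto
      then show "iter_log 3 x \<ge> iter_log (Suc 3) (real N) / 2"
        using elim by (simp add: eval_nat_numeral Y_def)
    qed
  qed
next
  case (step j)
  show ?case
    \<comment> \<open>From \<open>T \<ge> 4\<close> follows \<open>ln 2 \<le> ln T / 2\<close>, so
      \<open>ln (T / 2)\<close> is still at least \<open>ln T / 2\<close>.\<close>
    using step.IH eventually_iter_log_ge[of 4 "Suc j"]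
  proof eventually_elim
    case (elim N)
    define T where "T = iter_log (Suc j) (real N)"
    have "T \<ge> 4" using elim by (simp add: T_def)
    then have "ln T \<ge> ln (2 ^ 2)" by (intro ln_mono) auto
    then have "ln T \<ge> 2 * ln 2" by (subst (asm) ln_realpow) auto
    show ?case
    proof (intro allI impI)
      fix x assume "x \<ge> exp (sqrt (ln (ln (real N)) / 8))"
      then have "iter_log j x \<ge> T / 2" using elim by (auto simp: T_def)
      then have "ln (iter_log j x) \<ge> ln (T / 2)" using \<open>T \<ge> 4\<close> by (intro ln_mono) auto
      also have "ln (T / 2) = ln T - ln 2" using \<open>T \<ge> 4\<close> by (intro ln_divide_pos) auto
      finally show "iter_log (Suc j) x \<ge> iter_log (Suc (Suc j)) (real N) / 2"
        using \<open>ln T \<ge> 2 * ln 2\<close> by (simp add: T_def)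
    qed
  qed
qed

text \<open>The logarithms of \<open>(n + 1) / n\<close>, each at most \<open>1 / n\<close>,
  telescope.\<close>

lemma sum_inverse_ge_ln:
  fixes a b :: nat
  assumes "1 \<le> a" "a \<le> b"
  shows "ln ((real b + 1) / real a) \<le> (\<Sum>i=a..b. 1 / real i)"
proof -
  have ln_le: "ln ((real n + 1) / real n) \<le> 1 / real n" if "n \<ge> 1" for n
    using ln_add_one_self_le_self[of "1 / real n"] that by (simp add: field_simps)
  show ?thesis
    using assms(2)
  proof (induction b rule: dec_induct)
    case base
    then show ?case using ln_le[of a] assms by simp
  next
    case (step b)
    have "(real (Suc b) + 1) / real a = (real b + 1) / real a * ((real (Suc b) + 1) / real (Suc b))"
      by (simp add: add.commute)
    also have "ln \<dots> = ln ((real b + 1) / real a) + ln ((real (Suc b) + 1) / real (Suc b))"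
      using assms by (intro ln_mult_pos divide_pos_pos) auto
    also have "\<dots> \<le> (\<Sum>i=a..b. 1 / real i) + 1 / real (Suc b)"
      using step.IH ln_le[of "Suc b"] by simp
    finally show ?case using step.hyps by simp
  qed
qed

text \<open>The assumed bound is inserted at \<open>4 ^ i\<close> for \<open>i\<close> from
  \<open>sqrt (Y N)\<close> to \<open>Y N\<close>. There \<open>ln (4 ^ i) = i * ln 4\<close> yields
  a harmonic sum, which is the new factor, and the old product reappears with every index raised by
  one.\<close>

lemma log_card_egyptian_step:
  assumes "k \<ge> 2" "c > 0"
    and c: "eventually (\<lambda>N. c * (real N / ln (real N) * (\<Prod>j=3..k. iter_log j (real N)))
      \<le> log_card_egyptian N) sequentially"
  shows "\<exists>c>0. eventually (\<lambda>N. c * (real N / ln (real N) * (\<Prod>j=3..Suc k. iter_log j (real N)))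
      \<le> log_card_egyptian N) sequentially"
proof (intro exI conjI)
  \<comment> \<open>The losses are 8 from the dyadic sum, \<open>ln 4\<close> from
    \<open>ln (4 ^ i)\<close>, 8 from the harmonic sum, and a factor 2 for each of the
    \<open>k - 2\<close> iterated logarithms.\<close>
  define c' where "c' = c / (8 * ln 4 * 8 * 2 ^ (k - 2))"
  show "c' > 0" unfolding c'_def using assms by simp
  obtain n0 where n0: "\<And>n. n \<ge> n0 \<Longrightarrow>
      c * (real n / ln (real n) * (\<Prod>j=3..k. iter_log j (real n))) \<le> log_card_egyptian n"
    using c unfolding eventually_sequentially by auto
  \<comment> \<open>With \<open>4 \<le> exp 2\<close>, the divisor 8 makes
    \<open>4 ^ (I + 1)\<close> of order at most \<open>ln N\<close> to the power 1/4, safely below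
    \<open>sqrt (ln N)\<close>.\<close>
  define Y where "Y N = ln (ln (real N)) / 8" for N :: nat
  have "eventually (\<lambda>N. \<forall>j\<in>{3..k}. \<forall>x \<ge> exp (sqrt (Y N)). iter_log j x \<ge> iter_log (Suc j) (real N) / 2) sequentially"
    unfolding Y_def by (intro eventually_ball_finite ballI iter_log_ge_half) auto
  moreover have "eventually (\<lambda>N. \<forall>j\<in>{3..k}. iter_log (Suc j) (real N) \<ge> 0) sequentially"
    by (intro eventually_ball_finite ballI eventually_iter_log_ge) auto
  moreover have "eventually (\<lambda>N. ln (Y N / (sqrt (Y N) + 1)) \<ge> ln (ln (ln (real N))) / 8) sequentially"
    unfolding Y_def by real_asymp
  moreover have "eventually (\<lambda>N. exp (2 * (Y N + 1)) \<le> sqrt (ln (real N))) sequentially"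
    unfolding Y_def by real_asymp
  \<comment> \<open>With \<open>i < 4 ^ i\<close> this makes the assumed bound available at every
    \<open>4 ^ i\<close> used.\<close>
  moreover have "eventually (\<lambda>N. sqrt (Y N) \<ge> real n0 + 1) sequentially"
    unfolding Y_def by real_asymp
  moreover have "eventually (\<lambda>N. sqrt (Y N) + 2 \<le> Y N) sequentially"
    unfolding Y_def by real_asymp
  ultimately show "eventually (\<lambda>N. c' * (real N / ln (real N) * (\<Prod>j=3..Suc k. iter_log j (real N)))
      \<le> log_card_egyptian N) sequentially"
    using log_card_egyptian_ge_dyadic_sum eventually_ge_at_top[of 2]
  proof eventually_elim
    case (elim N)
    define a where "a = nat \<lceil>sqrt (Y N)\<rceil>"
    define I where "I = nat \<lfloor>Y N\<rfloor>"
    define G where "G = (\<Prod>j=3..k. iter_log (Suc j) (real N))"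
    have "Y N > 0" "sqrt (Y N) > 0" using elim by linarith+
    have a: "real a \<ge> sqrt (Y N)" "real a \<le> sqrt (Y N) + 1"
      unfolding a_def using \<open>sqrt (Y N) > 0\<close> by linarith+
    have I: "real I \<le> Y N" "Y N \<le> real I + 1" unfolding I_def using \<open>Y N > 0\<close> by linarith+
    have "a \<ge> 1" "a \<le> I" using a I elim by linarith+
    have "G \<ge> 0" unfolding G_def using elim by (intro prod_nonneg) auto
    have "exp 1 \<ge> (2 :: real)" using exp_ge_add_one_self[of 1] by simp
    have "4 \<le> exp (2 :: real)"
      using mult_mono[OF \<open>exp 1 \<ge> 2\<close> \<open>exp 1 \<ge> 2\<close>] by (simp flip: exp_add)
    then have "4 ^ (I + 1) \<le> exp (2 :: real) ^ (I + 1)" by (intro power_mono) auto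
    also have "\<dots> = exp (2 * (real I + 1))" by (simp add: exp_of_nat_mult[symmetric] exp_add algebra_simps)
    also have "\<dots> \<le> exp (2 * (Y N + 1))" using I by simp
    also have "\<dots> \<le> sqrt (ln (real N))" using elim by simp
    finally have I4: "4 ^ (I + 1) \<le> sqrt (ln (real N))" .
    have term_ge: "c * G / (2 ^ (k - 2) * ln 4) * (1 / real i) \<le> log_card_egyptian (4 ^ i) / 4 ^ i"
      if i: "i \<in> {a..I}" for i
    proof -
      have "real i \<ge> sqrt (Y N)" "i \<ge> 1" using i a \<open>a \<ge> 1\<close> by auto
      have "i < 4 ^ i" by (rule power_gt_expt) auto
      then have "4 ^ i \<ge> n0" using \<open>real i \<ge> sqrt (Y N)\<close> elim by linarith
      have "exp 1 \<le> (4 :: real)" using exp_le by linarith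
      then have "exp 1 ^ i \<le> (4 :: real) ^ i" by (intro power_mono) auto
      then have "exp (real i) \<le> 4 ^ i" by (simp add: exp_of_nat_mult[symmetric])
      moreover have "exp (sqrt (Y N)) \<le> exp (real i)" using \<open>real i \<ge> sqrt (Y N)\<close> by simp
      ultimately have "exp (sqrt (Y N)) \<le> 4 ^ i" by linarith
      have "G / 2 ^ (k - 2) = (\<Prod>j=3..k. iter_log (Suc j) (real N) / 2)"
        unfolding G_def prod_dividef using assms by simp
      also have "\<dots> \<le> (\<Prod>j=3..k. iter_log j (4 ^ i))"
        using elim \<open>exp (sqrt (Y N)) \<le> 4 ^ i\<close> by (intro prod_mono) auto
      finally have "G / 2 ^ (k - 2) \<le> (\<Prod>j=3..k. iter_log j (4 ^ i))" .
      then have "c * (4 ^ i / (real i * ln 4) * (G / 2 ^ (k - 2)))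
          \<le> c * (4 ^ i / (real i * ln 4) * (\<Prod>j=3..k. iter_log j (4 ^ i)))"
        using assms by (intro mult_left_mono) auto
      also have "\<dots> \<le> log_card_egyptian (4 ^ i)"
        using n0[OF \<open>4 ^ i \<ge> n0\<close>] by (simp add: ln_realpow)
      finally show ?thesis using \<open>i \<ge> 1\<close> by (simp add: field_simps)
    qed
    have "ln (ln (ln (real N))) / 8 \<le> ln (Y N / (sqrt (Y N) + 1))" using elim by simp
    also have "\<dots> \<le> ln ((real I + 1) / real a)"
    proof (intro ln_mono frac_le divide_pos_pos)
      show "0 < sqrt (Y N) + 1" using \<open>sqrt (Y N) > 0\<close> by linarith
    qed (use a I \<open>a \<ge> 1\<close> \<open>Y N > 0\<close> in auto)
    also have "\<dots> \<le> (\<Sum>i=a..I. 1 / real i)"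
      using \<open>a \<ge> 1\<close> \<open>a \<le> I\<close> by (rule sum_inverse_ge_ln)
    finally have "c * G / (2 ^ (k - 2) * ln 4) * (ln (ln (ln (real N))) / 8)
        \<le> c * G / (2 ^ (k - 2) * ln 4) * (\<Sum>i=a..I. 1 / real i)"
      using assms \<open>G \<ge> 0\<close> by (intro mult_left_mono) auto
    also have "\<dots> \<le> (\<Sum>i=a..I. log_card_egyptian (4 ^ i) / 4 ^ i)"
      unfolding sum_distrib_left using term_ge by (intro sum_mono)
    also have "\<dots> \<le> (\<Sum>i=1..I. log_card_egyptian (4 ^ i) / 4 ^ i)"
      using \<open>a \<ge> 1\<close> by (intro sum_mono2) (auto intro!: divide_nonneg_nonneg log_card_egyptian_nonneg)
    finally have "real N / (8 * ln (real N)) * (c * G / (2 ^ (k - 2) * ln 4) * (ln (ln (ln (real N))) / 8))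
        \<le> real N / (8 * ln (real N)) * (\<Sum>i=1..I. log_card_egyptian (4 ^ i) / 4 ^ i)"
      using elim by (intro mult_left_mono) auto
    also have "\<dots> \<le> log_card_egyptian N" using elim I4 by blast
    finally have "real N / (8 * ln (real N)) * (c * G / (2 ^ (k - 2) * ln 4) * (ln (ln (ln (real N))) / 8))
        \<le> log_card_egyptian N" .
    moreover have "(\<Prod>j=3..Suc k. iter_log j (real N)) = ln (ln (ln (real N))) * G"
    proof -
      have "(\<Prod>j=3..Suc k. iter_log j (real N)) = iter_log 3 (real N) * (\<Prod>j=Suc 3..Suc k. iter_log j (real N))"
        using assms by (intro prod.atLeast_Suc_atMost) auto
      also have "(\<Prod>j=Suc 3..Suc k. iter_log j (real N)) = G"
        unfolding G_def by (rule prod.shift_bounds_cl_Suc_ivl)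
      also have "iter_log 3 (real N) = ln (ln (ln (real N)))" by (simp add: eval_nat_numeral)
      finally show ?thesis .
    qed
    ultimately show ?case by (simp add: c'_def mult_ac)
  qed
qed

lemma log_card_egyptian_lower_bound:
  assumes "k \<ge> 2"
  shows "\<exists>c>0. eventually (\<lambda>N. c * (real N / ln (real N) * (\<Prod>j=3..k. iter_log j (real N)))
      \<le> log_card_egyptian N) sequentially"
  using assms
proof (induction k rule: dec_induct)
  case base
  \<comment> \<open>For \<open>k = 2\<close> the product is empty. The single term
    \<open>i = 1\<close> suffices: it is at least \<open>ln 2 / 4\<close>, whence the constant
    \<open>ln 2 / 32\<close>.\<close>
  have "eventually (\<lambda>N. 4 ^ (1 + 1) \<le> sqrt (ln (real N))) sequentially" by real_asymp
  then have "eventually (\<lambda>N. ln 2 / 32 * (real N / ln (real N)) \<le> log_card_egyptian N) sequentially"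
    using log_card_egyptian_ge_dyadic_sum eventually_ge_at_top[of 2]
  proof eventually_elim
    case (elim N)
    have "ln 2 / 32 * (real N / ln (real N)) = real N / (8 * ln (real N)) * (ln 2 / 4)" by simp
    also have "\<dots> \<le> real N / (8 * ln (real N)) * (\<Sum>i=1..1. log_card_egyptian (4 ^ i) / 4 ^ i)"
      using elim log_card_egyptian_ge_ln2[of 4] by (intro mult_left_mono) auto
    also have "\<dots> \<le> log_card_egyptian N" using elim by blast
    finally show ?case .
  qed
  then show ?case by (intro exI[of _ "ln 2 / 32"]) simp
next
  case (step k)
  then show ?case using log_card_egyptian_step by blast
qed

theorem theorem1p3:
  fixes k :: nat
  assumes "k \<ge> 3"
  shows "\<exists>N0::nat. \<forall>N\<ge>N0.
    ln (real (card (egyptian_sums N))) >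
      real N / ln (real N) * (\<Prod>j=3..k. iter_log j (real N))"
proof -
  \<comment> \<open>The bound is taken with one factor more than claimed: this factor eventually
    exceeds \<open>2 / c\<close>, which removes the constant and makes the inequality
    strict.\<close>
  obtain c where "c > 0" and
    c: "eventually (\<lambda>N. c * (real N / ln (real N) * (\<Prod>j=3..Suc k. iter_log j (real N)))
      \<le> log_card_egyptian N) sequentially"
    using log_card_egyptian_lower_bound[of "Suc k"] assms by auto
  have "eventually (\<lambda>N. \<forall>j\<in>{3..k}. iter_log j (real N) \<ge> 1) sequentially"
    by (intro eventually_ball_finite ballI eventually_iter_log_ge) auto
  with c have "eventually (\<lambda>N. real N / ln (real N) * (\<Prod>j=3..k. iter_log j (real N))
      < log_card_egyptian N) sequentially"
    using eventually_iter_log_ge[of "2 / c" "Suc k"] eventually_ge_at_top[of 2]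
  proof eventually_elim
    case (elim N)
    define F where "F = real N / ln (real N) * (\<Prod>j=3..k. iter_log j (real N))"
    have "(\<Prod>j=3..k. iter_log j (real N)) > 0" using elim by (intro prod_pos) fastforce
    then have "F > 0" unfolding F_def using elim by (intro mult_pos_pos divide_pos_pos) auto
    have "F < 2 * F" using \<open>F > 0\<close> by simp
    also have "\<dots> = F * (c * (2 / c))" using \<open>c > 0\<close> by simp
    also have "\<dots> \<le> F * (c * iter_log (Suc k) (real N))"
      using elim \<open>c > 0\<close> \<open>F > 0\<close> by (intro mult_left_mono) (auto simp del: iter_log.simps)
    also have "\<dots> = c * (real N / ln (real N) * (\<Prod>j=3..Suc k. iter_log j (real N)))"
      unfolding F_def using assms by (simp add: mult_ac)
    also have "\<dots> \<le> log_card_egyptian N" using elim by simp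
    finally show ?case unfolding F_def .
  qed
  then show ?thesis unfolding log_card_egyptian_def eventually_sequentially .
qed

end
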